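(* Let $\Gamma$ be an irreducible subgroup of $\mathrm{SU}(2,1)$ and let $A\in\Gamma$ be a loxodromic element with eigenvalues $\lambda_1=\lambda e^{i\varphi}$, $\lambda_2=e^{-2i\varphi}$, $\lambda_3=\lambda^{-1}e^{i\varphi}$, where $\lambda>0$, $\lambda\neq 1$, $\varphi\in(-\pi,\pi]$. Then $\Gamma$ is conjugate in $\mathrm{SU}(2,1)$ to a subgroup of $\mathrm{SU}(2,1,\mathbb{Q}(\Gamma,\lambda))$.
   Context: Let $V=\mathbb{C}^{3}$ with the Hermitian form $\langle z,w\rangle=z_1\bar w_3+z_2\bar w_2+z_3\bar w_1$ of signature $(2,1)$. $\mathrm{SU}(2,1)$ is the group of $3\times 3$ complex matrices of determinant $1$ preserving this form. The complex hyperbolic plane $\mathbf{H}^2_{\mathbb{C}}\subset\mathbb{P}(V)$ is the set of projective classes of vectors $v$ with $\langle v,v\rangle<0$, and its boundary $\partial\mathbf{H}^2_{\mathbb{C}}$ is the set of classes of nonzero $v$ with $\langle v,v\rangle=0$. An element of $\mathrm{SU}(2,1)$ is loxodromic if its action on $\mathbf{H}^2_{\mathbb{C}}\cup\partial\mathbf{H}^2_{\mathbb{C}}$ has no fixed point in $\mathbf{H}^2_{\mathbb{C}}$ and exactly two fixed points on $\partial\mathbf{H}^2_{\mathbb{C}}$; its eigenvalues can always be written as $\lambda e^{i\varphi}, e^{-2i\varphi},\lambda^{-1}e^{i\varphi}$ with $\lambda>0$, $\lambda\ne1$, $\varphi\in(-\pi,\pi]$. A subgroup $\Gamma$ of $\mathrm{SU}(2,1)$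 is reducible if it has an invariant proper nonzero $\mathbb{C}$-subspace of $V$, and irreducible otherwise; $\Gamma$ is not assumed to be discrete. The trace field $\mathbb{Q}(\Gamma)$ is the subfield of $\mathbb{C}$ generated over $\mathbb{Q}$ by the traces of all elements of $\Gamma$, and $\mathbb{Q}(\Gamma,\lambda)$ is the field generated by $\mathbb{Q}(\Gamma)$ and $\lambda$. For a subfield $k\subset\mathbb{C}$, $\mathrm{SU}(2,1,k)=\mathrm{SU}(2,1)\cap \mathrm{M}(3,k)$. *)

theory Defs
  imports
    "HOL-Analysis.Analysis"
    "HOL-Algebra.Generated_Fields"
    "HOL-Algebra.Algebraic_Closure_Type"
begin

definition herm :: "complex^3 \<Rightarrow> complex^3 \<Rightarrow> complex" where
  "herm z w = z $ 1 * cnj (w $ 3) + z $ 2 * cnj (w $ 2) + z $ 3 * cnj (w $ 1)"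

lemma herm_self_real: "herm v v \<in> \<real>"
  by (simp add: complex_is_Real_iff herm_def)

definition SU21 :: "(complex^3^3) monoid" where
  "SU21 = \<lparr>carrier = {A. det A = 1 \<and> (\<forall>z w. herm (A *v z) (A *v w) = herm z w)},
           monoid.mult = (**), one = mat 1\<rparr>"

lemma SU21_simps:
  "A \<in> carrier SU21 \<longleftrightarrow> det A = 1 \<and> (\<forall>z w. herm (A *v z) (A *v w) = herm z w)"
  "A \<otimes>\<^bsub>SU21\<^esub> B = A ** B"
  "\<one>\<^bsub>SU21\<^esub> = mat 1"
  by (simp_all add: SU21_def)

lemma group_SU21: "group SU21"
proof (rule groupI)
  fix A assume A: "A \<in> carrier SU21"
  then have "invertible A"
    by (simp add: SU21_simps invertible_det_nz)
  then obtain B where AB: "A ** B = mat 1" and BA: "B ** A = mat 1"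
    by (auto simp: invertible_def)
  have "det B = 1"
    using A det_mul[of A B] AB by (simp add: SU21_simps)
  moreover have "herm (B *v z) (B *v w) = herm z w" for z w
  proof -
    have "herm (A *v (B *v z)) (A *v (B *v w)) = herm (B *v z) (B *v w)"
      using A by (simp add: SU21_simps)
    then show ?thesis
      by (simp add: matrix_vector_mul_assoc AB)
  qed
  ultimately show "\<exists>B\<in>carrier SU21. B \<otimes>\<^bsub>SU21\<^esub> A = \<one>\<^bsub>SU21\<^esub>"
    using BA by (auto simp: SU21_simps)
qed (auto simp: SU21_simps det_mul matrix_mul_assoc simp flip: matrix_vector_mul_assoc)

(* A point of P(V) is represented by the complex line that it spans. *)

definition H2C :: "(complex^3) set set" where
  "H2C = {vec.span {v} | v. Re (herm v v) < 0}"

definition boundary_H2C :: "(complex^3) set set" where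
  "boundary_H2C = {vec.span {v} | v. v \<noteq> 0 \<and> herm v v = 0}"

definition proj_action :: "complex^3^3 \<Rightarrow> (complex^3) set \<Rightarrow> (complex^3) set" where
  "proj_action A L = (*v) A ` L"

definition loxodromic :: "complex^3^3 \<Rightarrow> bool" where
  "loxodromic A \<longleftrightarrow> A \<in> carrier SU21 \<and>
     {L \<in> H2C. proj_action A L = L} = {} \<and>
     card {L \<in> boundary_H2C. proj_action A L = L} = 2"

definition eigenvalues :: "complex^3^3 \<Rightarrow> complex set" where
  "eigenvalues A = {\<mu>. \<exists>v. v \<noteq> 0 \<and> A *v v = \<mu> *s v}"

(* vec.subspace means closed under complex scalars; plain subspace would mean real scalars. *)

definition reducible :: "(complex^3^3) set \<Rightarrow> bool" where
  "reducible \<Gamma> \<longleftrightarrow> (\<exists>W. vec.subspace W \<and> W \<noteq> {0} \<and> W \<noteq> UNIV \<and>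
     (\<forall>g\<in>\<Gamma>. (*v) g ` W \<subseteq> W))"

abbreviation irreducible_group :: "(complex^3^3) set \<Rightarrow> bool" where
  "irreducible_group \<Gamma> \<equiv> \<not> reducible \<Gamma>"

abbreviation complex_ring :: "complex ring" where
  "complex_ring \<equiv> ring_of_type_algebra"

(* A subfield of the complex numbers contains the rationals, so the field generated over the
   rationals is just the generated subfield. *)

definition trace_field :: "(complex^3^3) set \<Rightarrow> complex set" where
  "trace_field \<Gamma> = generate_field complex_ring (trace ` \<Gamma>)"

definition trace_field_adjoin :: "(complex^3^3) set \<Rightarrow> complex \<Rightarrow> complex set" where
  "trace_field_adjoin \<Gamma> x = generate_field complex_ring (insert x (trace_field \<Gamma>))"

definition SU21_over :: "complex set \<Rightarrow> (complex^3^3) set" where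
  "SU21_over k = carrier SU21 \<inter> {A. \<forall>i j. A $ i $ j \<in> k}"

definition conjugate_by :: "complex^3^3 \<Rightarrow> (complex^3^3) set \<Rightarrow> (complex^3^3) set" where
  "conjugate_by g \<Gamma> = (\<lambda>h. g \<otimes>\<^bsub>SU21\<^esub> h \<otimes>\<^bsub>SU21\<^esub> inv\<^bsub>SU21\<^esub> g) ` \<Gamma>"

end

theory Submission
  imports Defs
begin

text \<open>Write \<open>u = e\<^sup>i\<^sup>\<phi>\<close> and \<open>k = \<rat>(\<Gamma>, \<lambda>)\<close>. The traces of \<open>A\<close> and of its inverse determine \<open>u\<close>
  rationally over \<open>\<rat>(\<lambda>)\<close>, so the eigenvalues of \<open>A\<close> lie in \<open>k\<close>. The eigenvectors of \<open>A\<close> form, up to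
  scaling, a frame with the standard Gram matrix, and irreducibility provides \<open>B \<in> \<Gamma>\<close> whose entry
  \<open>B\<^sub>2\<^sub>1\<close> in this frame is nonzero; the remaining freedom in the scaling makes this entry equal to 1, and
  then the (3,2) entry of the inverse of \<open>B\<close> is also 1 because \<open>B\<close> is unitary. Inserting powers of
  the diagonal matrix \<open>A\<close> into traces of products and inverting a Vandermonde matrix shows that all
  cyclic products \<open>X\<^sub>i\<^sub>i\<close>, \<open>X\<^sub>i\<^sub>j Y\<^sub>j\<^sub>i\<close> and \<open>X\<^sub>i\<^sub>j Y\<^sub>j\<^sub>k Z\<^sub>k\<^sub>i\<close> of matrix entries lie in \<open>k\<close>.
  The two entries equal to 1 then force every single entry into \<open>k\<close>.\<close>

no_notation fps_nth (infixl "$" 75)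

text \<open>The polynomial (t - y) (t - z) in t vanishes at \<open>y\<close> and \<open>z\<close>,
  so combining the three weighted sums with its coefficients isolates the term in
  \<open>a\<close>.\<close>

lemma vandermonde3:
  fixes a b c x y z :: "'a :: comm_ring_1"
  shows "a * ((x - y) * (x - z)) = (x * (x * a) + y * (y * b) + z * (z * c))
    - (y + z) * (x * a + y * b + z * c) + y * z * (a + b + c)"
  by (simp add: algebra_simps)

section \<open>Subfields of the complex numbers\<close>

locale complex_subfield =
  fixes K :: "complex set"
  assumes one_mem: "1 \<in> K"
    and add_mem: "x \<in> K \<Longrightarrow> y \<in> K \<Longrightarrow> x + y \<in> K"
    and uminus_mem: "x \<in> K \<Longrightarrow> - x \<in> K"
    and mult_mem: "x \<in> K \<Longrightarrow> y \<in> K \<Longrightarrow> x * y \<in> K"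
    and inverse_mem: "x \<in> K \<Longrightarrow> inverse x \<in> K"
begin

lemma diff_mem: "x \<in> K \<Longrightarrow> y \<in> K \<Longrightarrow> x - y \<in> K"
  using add_mem[OF _ uminus_mem] by simp

lemma divide_mem: "x \<in> K \<Longrightarrow> y \<in> K \<Longrightarrow> x / y \<in> K"
  by (simp add: divide_inverse inverse_mem mult_mem)

lemma power_mem: "x \<in> K \<Longrightarrow> x ^ n \<in> K"
  by (induction n) (auto intro: one_mem mult_mem)

lemmas arith_mem = one_mem add_mem uminus_mem mult_mem inverse_mem diff_mem divide_mem power_mem

lemma mult_cancel_mem:
  assumes "x * y \<in> K" "y \<in> K" "y \<noteq> 0"
  shows "x \<in> K"
  using divide_mem[OF assms(1,2)] assms(3) by simp

text \<open>A Vandermonde system with distinct nodes in \<open>K\<close> is solved by division in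
  \<open>K\<close>. The nodes will be the eigenvalues of \<open>A\<close>.\<close>

lemma vandermonde_mem:
  fixes d f :: "3 \<Rightarrow> complex"
  assumes d: "inj d" "\<And>i. d i \<in> K"
    and S: "(\<Sum>i\<in>UNIV. f i) \<in> K" "(\<Sum>i\<in>UNIV. d i * f i) \<in> K"
      "(\<Sum>i\<in>UNIV. d i * (d i * f i)) \<in> K"
  shows "f i \<in> K"
proof -
  have solve: "a \<in> K"
    if "x \<noteq> y" "x \<noteq> z" "x \<in> K" "y \<in> K" "z \<in> K" "a + b + c \<in> K" "x * a + y * b + z * c \<in> K"
      "x * (x * a) + y * (y * b) + z * (z * c) \<in> K" for x y z a b c
  proof (rule mult_cancel_mem)
    show "a * ((x - y) * (x - z)) \<in> K"
      unfolding vandermonde3[of a x y z b c] using that by (simp add: arith_mem)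
  qed (use that in \<open>auto intro: arith_mem\<close>)
  have ne: "d 1 \<noteq> d 2" "d 1 \<noteq> d 3" "d 2 \<noteq> d 3"
    using d(1) by (auto dest: injD)
  have "f 1 \<in> K"
    by (rule solve[of "d 1" "d 2" "d 3" _ "f 2" "f 3"]) (use d S ne in \<open>simp_all add: sum_3\<close>)
  moreover have "f 2 \<in> K"
    by (rule solve[of "d 2" "d 1" "d 3" _ "f 1" "f 3"]) (use d S ne in \<open>simp_all add: sum_3 add_ac\<close>)
  moreover have "f 3 \<in> K"
    by (rule solve[of "d 3" "d 1" "d 2" _ "f 1" "f 2"]) (use d S ne in \<open>simp_all add: sum_3 add_ac\<close>)
  ultimately show ?thesis
    using exhaust_3[of i] by auto
qed

end

lemma complex_subfield_generate_field: "complex_subfield (generate_field complex_ring S)"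
proof -
  interpret F: field complex_ring ..
  have carr: "carrier complex_ring = UNIV"
    and ops: "x \<oplus>\<^bsub>complex_ring\<^esub> y = x + y" "x \<otimes>\<^bsub>complex_ring\<^esub> y = x * y"
      "\<one>\<^bsub>complex_ring\<^esub> = 1" "\<zero>\<^bsub>complex_ring\<^esub> = 0" for x y
    by (simp_all add: ring_of_type_algebra_def)
  have uminus: "\<ominus>\<^bsub>complex_ring\<^esub> x = - x" for x
    by (rule F.minus_equality) (simp_all add: carr ops)
  have inverse: "inv\<^bsub>complex_ring\<^esub> x = inverse x" if "x \<noteq> 0" for x
    by (rule F.comm_inv_char) (simp_all add: carr ops that)
  have zero: "0 \<in> generate_field complex_ring S"
    using F.zero_in_generate[of S] by (simp add: ops)
  show ?thesis
  proof
    show "1 \<in> generate_field complex_ring S"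
      using generate_field.one[of complex_ring S] by (simp add: ops)
    fix x assume x: "x \<in> generate_field complex_ring S"
    show "- x \<in> generate_field complex_ring S"
      using generate_field.a_inv[OF x] by (simp add: uminus)
    \<comment> \<open>\<open>generate_field\<close> inverts only nonzero elements; the other case
      holds because inverse 0 = 0.\<close>
    show "inverse x \<in> generate_field complex_ring S"
      using generate_field.m_inv[OF x] zero by (cases "x = 0") (simp_all add: inverse ops)
    fix y assume y: "y \<in> generate_field complex_ring S"
    show "x + y \<in> generate_field complex_ring S"
      using generate_field.eng_add[OF x y] by (simp add: ops)
    show "x * y \<in> generate_field complex_ring S"
      using generate_field.eng_mult[OF x y] by (simp add: ops)
  qed
qed

section \<open>The eigenvalues lie in the field\<close>

text \<open>The right side is l^3 + l^-3, which exceeds 2, while the left side is 2 Re (u^3), which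
  is at most 2.\<close>

lemma cubic_chebyshev_neq:
  fixes l :: real and u :: complex
  assumes "l > 0" "l \<noteq> 1" "norm u = 1"
  defines "s \<equiv> of_real (l + inverse l) :: complex"
  shows "u ^ 3 + inverse u ^ 3 \<noteq> s ^ 3 - 3 * s"
proof
  let ?s = "l + inverse l"
  have cubic: "x ^ 3 - 3 * x - 2 = (x - 2) * (x + 1)\<^sup>2" for x :: real
    by (simp add: power2_eq_square power3_eq_cube algebra_simps)
  assume eq: "u ^ 3 + inverse u ^ 3 = s ^ 3 - 3 * s"
  have "inverse u = cnj u"
    using assms(3) by (metis complex_div_cnj div_by_1 inverse_eq_divide mult_1 of_real_1 power_one)
  then have "of_real (2 * Re (u ^ 3)) = (of_real (?s ^ 3 - 3 * ?s) :: complex)"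
    using complex_add_cnj[of "u ^ 3"] eq by (simp add: s_def)
  then have *: "2 * Re (u ^ 3) = ?s ^ 3 - 3 * ?s"
    by (simp only: of_real_eq_iff)
  have "Re (u ^ 3) \<le> 1"
    using complex_Re_le_cmod[of "u ^ 3"] assms(3) by (simp add: norm_power)
  moreover have "?s ^ 3 - 3 * ?s - 2 = (?s - 2) * (?s + 1)\<^sup>2"
    by (rule cubic)
  moreover have pos: "?s - 2 > 0"
  proof -
    have "l * inverse l = 1"
      using assms(1) by simp
    then have "l * (?s - 2) = (l - 1)\<^sup>2"
      unfolding power2_eq_square by (simp add: distrib_left left_diff_distrib right_diff_distrib)
    then have "l * (?s - 2) > 0"
      using assms(2) by simp
    then show ?thesis
      using assms(1) zero_less_mult_pos by blast
  qed
  moreover have "(?s - 2) * (?s + 1)\<^sup>2 > 0"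
  proof (rule mult_pos_pos[OF pos], rule zero_less_power)
    show "?s + 1 > 0" using pos by linarith
  qed
  ultimately show False
    using * by linarith
qed

text \<open>Both traces are polynomials in \<open>u\<close>, \<open>1 / u\<close> and \<open>s = l + 1 / l\<close>; eliminating the higher
  powers of \<open>u\<close> between them leaves a linear equation for \<open>u\<close>.\<close>

lemma (in complex_subfield) unit_eigenvalue_mem:
  fixes l :: real and u :: complex
  assumes l: "l > 0" "l \<noteq> 1" "of_real l \<in> K" and u: "norm u = 1"
    and t: "u * of_real (l + inverse l) + inverse u ^ 2 \<in> K" (is "?t \<in> K")
    and t': "inverse u * of_real (l + inverse l) + u ^ 2 \<in> K" (is "?t' \<in> K")
  shows "u \<in> K"
proof -
  define s :: complex where "s = of_real (l + inverse l)"
  define v where "v = inverse u"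
  have "u \<noteq> 0" using u by auto
  then have uv: "u * v = 1" by (simp add: v_def)
  have sK: "s \<in> K" using l by (auto simp: s_def intro: arith_mem)
  define T where "T = u * s + v ^ 2"
  define T' where "T' = v * s + u ^ 2"
  have TK: "T \<in> K" "T' \<in> K" using t t' by (simp_all add: T_def T'_def v_def s_def)
  \<comment> \<open>\<open>B\<close> is the coefficient in the linear equation u B = s (T^2 - T'
    (s^2 - 1)). Multiplying by powers of \<open>u\<close> turns both sides into polynomials in
    \<open>s\<close> and \<open>w\<close>.\<close>
  define B where "B = T\<^sup>2 * T' - s\<^sup>2 * T'\<^sup>2 + (s\<^sup>2 - 1) * T"
  define w where "w = u ^ 3"
  have uT: "u\<^sup>2 * T = w * s + 1"
  proof -
    have "u\<^sup>2 * T = u ^ 3 * s + (u * v)\<^sup>2"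
      by (simp add: T_def power2_eq_square power3_eq_cube algebra_simps)
    then show ?thesis by (simp add: uv w_def)
  qed
  have uT': "u * T' = s + w"
  proof -
    have "u * T' = (u * v) * s + u ^ 3"
      by (simp add: T'_def power2_eq_square power3_eq_cube algebra_simps)
    then show ?thesis by (simp add: uv w_def)
  qed
  have "u ^ 5 * B = (u\<^sup>2 * T)\<^sup>2 * (u * T') - s\<^sup>2 * (u * T')\<^sup>2 * w + (s\<^sup>2 - 1) * (u\<^sup>2 * T) * w"
    by (simp add: B_def w_def eval_nat_numeral algebra_simps)
  then have B: "u ^ 5 * B = s * (w\<^sup>2 + 1 - w * (s ^ 3 - 3 * s))"
    unfolding uT uT' by (simp add: eval_nat_numeral algebra_simps)
  have "u ^ 4 * (s * (T\<^sup>2 - T' * (s\<^sup>2 - 1))) = s * ((u\<^sup>2 * T)\<^sup>2 - (u * T') * w * (s\<^sup>2 - 1))"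
    by (simp add: w_def eval_nat_numeral algebra_simps)
  also have "\<dots> = u ^ 4 * (u * B)"
  proof -
    have "u ^ 4 * (u * B) = u ^ 5 * B" by (simp add: eval_nat_numeral)
    then show ?thesis
      unfolding uT uT' B by (simp add: eval_nat_numeral algebra_simps)
  qed
  finally have "u * B = s * (T\<^sup>2 - T' * (s\<^sup>2 - 1))"
    using \<open>u \<noteq> 0\<close> by simp
  \<comment> \<open>As \<open>s\<close> is nonzero, \<open>B = 0\<close> would force w + 1/w = s^3 -
    3 s, which \<open>cubic_chebyshev_neq\<close> excludes.\<close>
  moreover have "B \<noteq> 0"
  proof
    assume "B = 0"
    moreover have "s \<noteq> 0"
      unfolding s_def of_real_eq_0_iff using l(1) by (smt (verit) positive_imp_inverse_positive)
    ultimately have "w * w + 1 = w * (s ^ 3 - 3 * s)"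
      using B by (simp add: power2_eq_square)
    then have "w + inverse w = s ^ 3 - 3 * s"
      using \<open>u \<noteq> 0\<close> by (simp add: w_def field_simps)
    then show False
      using cubic_chebyshev_neq[OF l(1,2) u] by (simp add: s_def w_def power_inverse)
  qed
  moreover have "B \<in> K" "s * (T\<^sup>2 - T' * (s\<^sup>2 - 1)) \<in> K"
    using sK TK by (auto simp: B_def intro!: arith_mem)
  ultimately show ?thesis
    by (metis mult_cancel_mem)
qed

section \<open>Matrix entries\<close>

definition diag :: "(3 \<Rightarrow> complex) \<Rightarrow> complex^3^3" where
  "diag d = (\<chi> i j. if i = j then d i else 0)"

lemma diag_mult_nth: "(diag d ** B) $ i $ j = d i * B $ i $ j"
  using exhaust_3[of i] by (auto simp: diag_def matrix_matrix_mult_def sum_3)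

text \<open>The situation after conjugation: \<open>diag d\<close> is the conjugate of the
  loxodromic element, \<open>P\<close> that of the element chosen by irreducibility, and
  \<open>Q\<close> the inverse of \<open>P\<close>.\<close>

locale normalized_matrices = complex_subfield K for K +
  fixes G :: "(complex^3^3) set" and d :: "3 \<Rightarrow> complex" and P Q :: "complex^3^3"
  assumes mult_closed: "B \<in> G \<Longrightarrow> C \<in> G \<Longrightarrow> B ** C \<in> G"
    and trace_mem: "B \<in> G \<Longrightarrow> trace B \<in> K"
    and d_inj: "inj d" and d_mem: "d i \<in> K" and diag_in: "diag d \<in> G"
    and entry_nonzero: "\<exists>B\<in>G. B $ i $ j \<noteq> 0"
    and P: "P \<in> G" "P $ 2 $ 1 = 1"
    and Q: "Q \<in> G" "Q $ 3 $ 2 = 1"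
begin

lemma diagonal_mem:
  assumes "B \<in> G"
  shows "B $ i $ i \<in> K"
  by (rule vandermonde_mem[OF d_inj d_mem, where f = "\<lambda>i. B $ i $ i"])
     (use assms trace_mem[of B] trace_mem[of "diag d ** B"] trace_mem[of "diag d ** (diag d ** B)"]
       in \<open>simp_all add: trace_def diag_mult_nth mult_closed diag_in\<close>)

text \<open>With D = \<open>diag d\<close>, taking C, D C and D^2 C for \<open>Y\<close> weights the
  summands of the product entry by powers of \<open>d j\<close>, which separates them. The factor
  \<open>z\<close> carries the rest of a cycle, so cycles grow by one entry at a time.\<close>

lemma entry_product_mem:
  assumes prod: "\<And>Y. Y \<in> G \<Longrightarrow> (B ** Y) $ i $ k * z \<in> K" and "C \<in> G"
  shows "B $ i $ j * (C $ j $ k * z) \<in> K"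
proof -
  have "(\<Sum>j\<in>UNIV. B $ i $ j * (Y $ j $ k * z)) \<in> K" if "Y \<in> G" for Y
    using prod[OF that] by (simp add: matrix_matrix_mult_def sum_distrib_right mult.assoc)
  note sums = this[of C] this[of "diag d ** C"] this[of "diag d ** (diag d ** C)"]
  show ?thesis
    by (rule vandermonde_mem[OF d_inj d_mem, where f = "\<lambda>j. B $ i $ j * (C $ j $ k * z)"])
       (use sums \<open>C \<in> G\<close> in \<open>simp_all add: diag_mult_nth mult_closed diag_in mult_ac\<close>)
qed

lemma cycle2_mem:
  assumes "B \<in> G" "C \<in> G"
  shows "B $ i $ j * C $ j $ i \<in> K"
  using entry_product_mem[of B i i 1 C j] assms diagonal_mem[OF mult_closed] by simp

lemma cycle3_mem:
  assumes "B \<in> G" "C \<in> G" "E \<in> G"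
  shows "B $ i $ j * (C $ j $ k * E $ k $ i) \<in> K"
  by (rule entry_product_mem) (use assms in \<open>auto intro: cycle2_mem mult_closed\<close>)

text \<open>Entries above the diagonal close up to cycles through the entries 1 of \<open>P\<close>
  and \<open>Q\<close>. An entry below the diagonal is a 2-cycle divided by a nonzero entry in the
  transposed position.\<close>

lemma all_entries_mem:
  assumes B: "B \<in> G"
  shows "B $ i $ j \<in> K"
proof -
  have 12: "C $ 1 $ 2 \<in> K" and 23: "C $ 2 $ 3 \<in> K" and 13: "C $ 1 $ 3 \<in> K" if "C \<in> G" for C
    using cycle2_mem[OF that P(1), of 1 2] cycle2_mem[OF that Q(1), of 2 3]
      cycle3_mem[OF that Q(1) P(1), of 1 3 2] P Q by simp_all
  have "B $ j $ i \<in> K" if "\<And>C. C \<in> G \<Longrightarrow> C $ i $ j \<in> K" for i j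
    using entry_nonzero[of i j] that cycle2_mem[OF B] by (metis mult_cancel_mem)
  then show ?thesis
    using exhaust_3[of i] exhaust_3[of j] 12 13 23 B diagonal_mem by blast
qed

end

section \<open>The Hermitian form\<close>

lemma herm_linear:
  "herm (x + y) z = herm x z + herm y z" "herm z (x + y) = herm z x + herm z y"
  "herm (c *s x) z = c * herm x z" "herm z (c *s x) = cnj c * herm z x"
  "herm 0 z = 0" "herm z 0 = 0"
  by (simp_all add: herm_def algebra_simps)

lemma cnj_herm: "cnj (herm x y) = herm y x"
  by (simp add: herm_def)

text \<open>The index permutation of the antidiagonal Gram matrix of \<open>herm\<close>: pairing
  with the basis vector of index \<open>flip i\<close> reads off coordinate
  \<open>i\<close>.\<close>

definition flip :: "3 \<Rightarrow> 3" where
  "flip i = (if i = 1 then 3 else if i = 3 then 1 else 2)"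

lemma flip_simps [simp]: "flip 1 = 3" "flip 2 = 2" "flip 3 = 1"
  by (simp_all add: flip_def)

lemma herm_axis: "herm x (axis (flip i) 1) = x $ i"
  using exhaust_3[of i] by (auto simp: herm_def axis_def)

lemma herm_nondegenerate:
  assumes "\<And>w. herm w y = 0"
  shows "y = 0"
  using assms herm_axis[of y] by (metis cnj_herm complex_cnj_zero vec_eq_iff zero_index)

lemma matrix_mult_axis: "((M :: complex^3^3) *v axis j 1) $ i = M $ i $ j"
  using exhaust_3[of j] by (auto simp: matrix_vector_mult_def axis_def sum_3)

lemma norm_det_eq_1:
  assumes M: "\<And>z w. herm (M *v z) (M *v w) = herm z w"
  shows "norm (det M) = 1"
proof -
  \<comment> \<open>\<open>N\<close> is the adjoint of \<open>M\<close> with respect to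
    \<open>herm\<close>; for an isometry it is the inverse.\<close>
  define N :: "complex^3^3" where "N = (\<chi> i j. cnj (M $ flip j $ flip i))"
  have "(N ** M) $ i $ j = herm (M *v axis j 1) (M *v axis (flip i) 1)" for i j
    unfolding herm_def matrix_mult_axis
    by (simp add: N_def matrix_matrix_mult_def sum_3 algebra_simps)
  then have "N ** M = mat 1"
    by (simp add: vec_eq_iff M herm_axis) (simp add: axis_def mat_def)
  then have "det N * det M = 1"
    by (metis det_I det_mul)
  moreover have "det N = cnj (det M)"
    by (simp add: det_3 N_def algebra_simps)
  ultimately have "of_real ((norm (det M))\<^sup>2) = (1 :: complex)"
    by (simp only: complex_norm_square mult.commute)
  then show ?thesis
    by (metis norm_ge_zero of_real_eq_1_iff power2_eq_1_iff le_minus_one_simps(3))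
qed

text \<open>The determinant has modulus 1, so its inverse has a cube root of modulus 1. Scaling by
  this root puts an isometry into \<open>SU21\<close>.\<close>

lemma SU21_scalar_exists:
  assumes "\<And>z w. herm (M *v z) (M *v w) = herm z w"
  obtains c where "norm c = 1" "c ^ 3 * det M = 1"
proof -
  obtain \<theta> where \<theta>: "det M = cis \<theta>"
    using norm_det_eq_1[OF assms] by (metis cis_rcis_eq rcis_cmod_Arg)
  show thesis
    by (rule that[of "cis (- \<theta> / 3)"]) (simp_all add: \<theta> Complex.DeMoivre cis_mult)
qed

section \<open>Frames as changes of basis\<close>

definition frame :: "complex^3 \<Rightarrow> complex^3 \<Rightarrow> complex^3 \<Rightarrow> complex^3^3" where
  "frame u v w = (\<chi> i j. if j = 1 then u $ i else if j = 2 then v $ i else w $ i)"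

lemma frame_mult: "frame u v w *v x = x $ 1 *s u + x $ 2 *s v + x $ 3 *s w"
  by (simp add: vec_eq_iff frame_def matrix_vector_mult_def sum_3 mult_ac)

lemma frame_axis [simp]:
  "frame u v w *v axis 1 1 = u" "frame u v w *v axis 2 1 = v" "frame u v w *v axis 3 1 = w"
  by (simp_all add: vec_eq_iff matrix_mult_axis) (simp_all add: frame_def)

lemma frame_diag:
  assumes "A *v u = d 1 *s u" "A *v v = d 2 *s v" "A *v w = d 3 *s w"
  shows "A ** frame u v w = frame u v w ** diag d"
proof -
  have "(A *v u) $ i = d 1 * u $ i" "(A *v v) $ i = d 2 * v $ i" "(A *v w) $ i = d 3 * w $ i" for i
    by (simp_all add: assms)
  then show ?thesis
    by (simp add: vec_eq_iff forall_3 frame_def diag_def matrix_matrix_mult_def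
        matrix_vector_mult_def sum_3 mult_ac)
qed

text \<open>The assumptions give u, v, w the Gram matrix of the standard basis, up to conjugate
  symmetry.\<close>

lemma frame_herm:
  assumes "herm u u = 0" "herm u v = 0" "herm v w = 0" "herm w w = 0" "herm u w = 1" "herm v v = 1"
  shows "herm (frame u v w *v x) (frame u v w *v y) = herm x y"
proof -
  have "herm v u = 0" "herm w v = 0" "herm w u = 1"
    using assms by (metis cnj_herm complex_cnj_zero complex_cnj_one)+
  then show ?thesis
    by (simp add: frame_mult herm_linear assms algebra_simps) (simp add: herm_def)
qed

text \<open>Applying \<open>A\<close> once and twice to a linear relation gives, in each coordinate,
  a Vandermonde system whose only solution is zero.\<close>

lemma eigenvectors_frame_invertible:
  assumes ev: "A *v u = a *s u" "A *v v = b *s v" "A *v w = c *s w"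
    and nz: "u \<noteq> 0" "v \<noteq> 0" "w \<noteq> 0" and ne: "a \<noteq> b" "a \<noteq> c" "b \<noteq> c"
  shows "invertible (frame u v w)"
proof -
  have "x = 0" if x: "frame u v w *v x = 0" for x
  proof -
    have 0: "x $ 1 *s u + x $ 2 *s v + x $ 3 *s w = 0"
      using x by (simp add: frame_mult)
    have step: "(a * p) *s u + (b * q) *s v + (c * r) *s w = 0"
      if "p *s u + q *s v + r *s w = 0" for p q r
      using arg_cong[OF that, of "(*v) A"]
      by (simp add: matrix_vector_right_distrib matrix_vector_mult_scaleR vector_scalar_commute ev
          vec.scale mult.commute)
    note 1 = step[OF 0] note 2 = step[OF 1]
    have comp: "x $ 1 * u $ k + x $ 2 * v $ k + x $ 3 * w $ k = 0"
      "a * (x $ 1 * u $ k) + b * (x $ 2 * v $ k) + c * (x $ 3 * w $ k) = 0"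
      "a * (a * (x $ 1 * u $ k)) + b * (b * (x $ 2 * v $ k)) + c * (c * (x $ 3 * w $ k)) = 0" for k
      using arg_cong[OF 0, of "\<lambda>z. z $ k"] arg_cong[OF 1, of "\<lambda>z. z $ k"]
        arg_cong[OF 2, of "\<lambda>z. z $ k"] by (simp_all add: mult.assoc)
    have "x $ 1 * u $ k = 0" "x $ 2 * v $ k = 0" "x $ 3 * w $ k = 0" for k
      using vandermonde3[of "x $ 1 * u $ k" a b c "x $ 2 * v $ k" "x $ 3 * w $ k"]
        vandermonde3[of "x $ 2 * v $ k" b a c "x $ 1 * u $ k" "x $ 3 * w $ k"]
        vandermonde3[of "x $ 3 * w $ k" c a b "x $ 1 * u $ k" "x $ 2 * v $ k"] comp[of k] ne
      by (simp_all add: add_ac)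
    then show "x = 0"
      using nz by (simp add: vec_eq_iff forall_3) blast
  qed
  then show ?thesis
    using matrix_left_invertible_ker[of "frame u v w"] by (metis invertible_left_inverse)
qed

text \<open>Applying \<open>A\<close> multiplies the pairing by \<open>a * cnj b\<close> but also
  preserves it. The case v = w shows that eigenvectors with eigenvalue off the unit circle are
  null.\<close>

lemma eigenvectors_orthogonal:
  assumes "A \<in> carrier SU21" "A *v v = a *s v" "A *v w = b *s w" "a * cnj b \<noteq> 1"
  shows "herm v w = 0"
proof -
  have "herm v w = a * cnj b * herm v w"
    using assms(1) herm_linear(3,4) by (metis SU21_simps(1) assms(2,3) mult.assoc)
  then show ?thesis using assms(4) by simp
qed

section \<open>Groups\<close>

text \<open>Otherwise the vectors whose whole orbit is orthogonal to \<open>y\<close> form an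
  invariant subspace, nonzero because of \<open>x\<close> and proper by nondegeneracy.\<close>

lemma irreducible_pairing_nonzero:
  assumes \<Gamma>: "subgroup \<Gamma> SU21" "irreducible_group \<Gamma>" and "x \<noteq> 0" "y \<noteq> 0"
  shows "\<exists>B\<in>\<Gamma>. herm (B *v x) y \<noteq> 0"
proof (rule ccontr)
  assume none: "\<not> ?thesis"
  define W where "W = {w. \<forall>B\<in>\<Gamma>. herm (B *v w) y = 0}"
  have "vec.subspace W"
    by (auto simp: W_def vec.subspace_def matrix_vector_right_distrib vec.scale herm_linear)
  moreover have "W \<noteq> {0}"
    using none \<open>x \<noteq> 0\<close> by (auto simp: W_def)
  moreover have "W \<noteq> UNIV"
  proof
    assume "W = UNIV"
    moreover have "mat 1 \<in> \<Gamma>"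
      using subgroup.one_closed[OF \<Gamma>(1)] by (simp add: SU21_simps)
    ultimately have "herm w y = 0" for w
      unfolding W_def by (metis (mono_tags, lifting) UNIV_I matrix_vector_mul_lid mem_Collect_eq)
    then show False
      using herm_nondegenerate \<open>y \<noteq> 0\<close> by blast
  qed
  moreover have "(*v) B ` W \<subseteq> W" if "B \<in> \<Gamma>" for B
    using subgroup.m_closed[OF \<Gamma>(1) _ that] unfolding W_def SU21_simps
    by (auto simp: matrix_vector_mul_assoc)
  ultimately show False
    using \<Gamma>(2) unfolding reducible_def by blast
qed

text \<open>The restricted structure need not be a group, so its inverse, a definite description,
  has to be identified with that of \<open>G\<close> on elements of \<open>H\<close>.\<close>

lemma (in group) subgroup_restrict_carrier:
  assumes H: "subgroup H G" and "H \<subseteq> S" "S \<subseteq> carrier G"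
  shows "subgroup H (G\<lparr>carrier := S\<rparr>)"
proof
  fix x assume x: "x \<in> H"
  have "inv\<^bsub>G\<lparr>carrier := S\<rparr>\<^esub> x = inv x"
    unfolding m_inv_def[of "G\<lparr>carrier := S\<rparr>"]
  proof (rule the_equality)
    show "inv x \<in> carrier (G\<lparr>carrier := S\<rparr>) \<and>
        x \<otimes>\<^bsub>G\<lparr>carrier := S\<rparr>\<^esub> inv x = \<one>\<^bsub>G\<lparr>carrier := S\<rparr>\<^esub> \<and>
        inv x \<otimes>\<^bsub>G\<lparr>carrier := S\<rparr>\<^esub> x = \<one>\<^bsub>G\<lparr>carrier := S\<rparr>\<^esub>"
      using x assms subgroup.m_inv_closed[OF H x] subgroup.mem_carrier[OF H x] by auto
  next
    fix y assume "y \<in> carrier (G\<lparr>carrier := S\<rparr>) \<and>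
        x \<otimes>\<^bsub>G\<lparr>carrier := S\<rparr>\<^esub> y = \<one>\<^bsub>G\<lparr>carrier := S\<rparr>\<^esub> \<and>
        y \<otimes>\<^bsub>G\<lparr>carrier := S\<rparr>\<^esub> x = \<one>\<^bsub>G\<lparr>carrier := S\<rparr>\<^esub>"
    then show "y = inv x"
      using assms(3) subgroup.mem_carrier[OF H x] by (intro inv_equality[symmetric]) auto
  qed
  then show "inv\<^bsub>G\<lparr>carrier := S\<rparr>\<^esub> x \<in> H"
    using subgroup.m_inv_closed[OF H x] by simp
qed (use assms in \<open>auto intro: subgroup.m_closed subgroup.one_closed\<close>)

lemma conjugate_by_subgroup:
  assumes "g \<in> carrier SU21" "subgroup \<Gamma> SU21"
  shows "subgroup (conjugate_by g \<Gamma>) SU21"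
proof -
  interpret group SU21 by (rule group_SU21)
  have "g \<otimes>\<^bsub>SU21\<^esub> (x \<otimes>\<^bsub>SU21\<^esub> y) \<otimes>\<^bsub>SU21\<^esub> inv\<^bsub>SU21\<^esub> g =
      g \<otimes>\<^bsub>SU21\<^esub> x \<otimes>\<^bsub>SU21\<^esub> inv\<^bsub>SU21\<^esub> g \<otimes>\<^bsub>SU21\<^esub> (g \<otimes>\<^bsub>SU21\<^esub> y \<otimes>\<^bsub>SU21\<^esub> inv\<^bsub>SU21\<^esub> g)"
    if "x \<in> carrier SU21" "y \<in> carrier SU21" for x y
  proof -
    have "inv\<^bsub>SU21\<^esub> g \<otimes>\<^bsub>SU21\<^esub> (g \<otimes>\<^bsub>SU21\<^esub> z) = z" if "z \<in> carrier SU21" for z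
      using assms(1) that by (simp add: m_assoc[symmetric])
    then show ?thesis
      using assms(1) that by (simp add: m_assoc)
  qed
  then have "(\<lambda>h. g \<otimes>\<^bsub>SU21\<^esub> h \<otimes>\<^bsub>SU21\<^esub> inv\<^bsub>SU21\<^esub> g) \<in> hom SU21 SU21"
    using assms(1) by (intro homI) auto
  then interpret group_hom SU21 SU21 "\<lambda>h. g \<otimes>\<^bsub>SU21\<^esub> h \<otimes>\<^bsub>SU21\<^esub> inv\<^bsub>SU21\<^esub> g"
    by unfold_locales
  show ?thesis
    unfolding conjugate_by_def by (rule subgroup_img_is_subgroup[OF assms(2)])
qed

section \<open>Eigenvectors of loxodromic elements\<close>

lemma proj_action_span_eigenvector:
  assumes "A *v v = a *s v" "a \<noteq> 0"
  shows "proj_action A (vec.span {v}) = vec.span {v}"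
proof -
  have "A *v (c *s v) = (c * a) *s v" for c
    by (simp add: vec.scale assms(1))
  moreover have "c *s v \<in> range (\<lambda>c. (c * a) *s v)" for c
    using assms(2) by (intro range_eqI[of _ _ "c / a"]) simp
  ultimately show ?thesis
    unfolding proj_action_def vec.span_singleton by (auto simp: image_image)
qed

text \<open>A negative eigenvector would span a fixed point in \<open>H2C\<close>. This settles the
  sign of the middle eigenvector.\<close>

lemma loxodromic_eigenvector_nonneg:
  assumes "loxodromic A" "A *v v = a *s v" "a \<noteq> 0"
  shows "Re (herm v v) \<ge> 0"
proof (rule ccontr)
  assume "\<not> ?thesis"
  then have "vec.span {v} \<in> H2C"
    by (auto simp: H2C_def)
  then show False
    using assms proj_action_span_eigenvector[OF assms(2,3)] unfolding loxodromic_def by blast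
qed

lemma loxodromic_normal_frame:
  assumes \<Gamma>: "subgroup \<Gamma> SU21" "irreducible_group \<Gamma>" and A: "loxodromic A"
    and ev: "A *v v1 = d 1 *s v1" "A *v v2 = d 2 *s v2" "A *v v3 = d 3 *s v3"
    and nz: "v1 \<noteq> 0" "v2 \<noteq> 0" "v3 \<noteq> 0"
    and d: "inj d" "norm (d 1) \<noteq> 1" "norm (d 2) = 1" "norm (d 3) \<noteq> 1"
  obtains M B where "M \<in> carrier SU21" "A ** M = M ** diag d" "B \<in> \<Gamma>"
    "herm (B *v (M *v axis 1 1)) (M *v axis 2 1) = 1"
proof -
  have ASU: "A \<in> carrier SU21"
    using A by (simp add: loxodromic_def)
  have ne1: "x * cnj y \<noteq> 1" if "norm x * norm y \<noteq> 1" for x y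
    using that by (metis complex_mod_cnj norm_mult norm_one)
  have sq: "norm (d i) * norm (d i) \<noteq> 1" if "norm (d i) \<noteq> 1" for i
    using that by (metis norm_ge_zero power2_eq_1_iff power2_eq_square le_minus_one_simps(3))
  have orth: "herm v1 v1 = 0" "herm v1 v2 = 0" "herm v2 v3 = 0" "herm v3 v3 = 0"
    using d(2-4) sq[of 1] sq[of 3]
      eigenvectors_orthogonal[OF ASU ev(1) ev(1) ne1] eigenvectors_orthogonal[OF ASU ev(1) ev(2) ne1]
      eigenvectors_orthogonal[OF ASU ev(2) ev(3) ne1] eigenvectors_orthogonal[OF ASU ev(3) ev(3) ne1]
    by simp_all
  then have orth': "herm v2 v1 = 0" "herm v3 v2 = 0"
    by (metis cnj_herm complex_cnj_zero)+
  have ned: "d 1 \<noteq> d 2" "d 1 \<noteq> d 3" "d 2 \<noteq> d 3"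
    using d(1) by (auto dest: injD)
  obtain N where N: "frame v1 v2 v3 ** N = mat 1"
    using eigenvectors_frame_invertible[OF ev nz ned] by (auto simp: invertible_def)
  have all: "\<exists>x :: complex^3. w = x $ 1 *s v1 + x $ 2 *s v2 + x $ 3 *s v3" for w
    by (rule exI[of _ "N *v w"]) (simp add: frame_mult[symmetric] matrix_vector_mul_assoc N)
  \<comment> \<open>Otherwise \<open>v1\<close> would be orthogonal to the whole frame, against
    nondegeneracy; the same argument serves for \<open>v2\<close>.\<close>
  have a: "herm v1 v3 \<noteq> 0"
  proof
    assume "herm v1 v3 = 0"
    then have "herm v3 v1 = 0" by (metis cnj_herm complex_cnj_zero)
    then have "herm w v1 = 0" for w
      using all[of w] orth orth' by (auto simp: herm_linear)
    then show False using herm_nondegenerate nz by blast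
  qed
  have "herm v2 v2 \<noteq> 0"
  proof
    assume "herm v2 v2 = 0"
    then have "herm w v2 = 0" for w
      using all[of w] orth orth' by (auto simp: herm_linear)
    then show False using herm_nondegenerate nz by blast
  qed
  moreover obtain b where b: "herm v2 v2 = of_real b"
    using herm_self_real[of v2] by (auto elim: Reals_cases)
  moreover have "Re (herm v2 v2) \<ge> 0"
  proof (rule loxodromic_eigenvector_nonneg[OF A ev(2)])
    show "d 2 \<noteq> 0"
      using d(3) by (metis norm_zero zero_neq_one)
  qed
  ultimately have "b > 0" by simp
  obtain B where B: "B \<in> \<Gamma>" and "herm (B *v v1) v2 \<noteq> 0"
    using irreducible_pairing_nonzero[OF \<Gamma> nz(1,2)] by blast
  define \<beta> where "\<beta> = herm (B *v v1) v2"
  have "\<beta> \<noteq> 0" unfolding \<beta>_def by fact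
  define r :: complex where "r = of_real (sqrt b)"
  have r: "r \<noteq> 0" "cnj r = r" "r * r = of_real b"
    using \<open>b > 0\<close> by (simp_all add: r_def flip: of_real_mult)
  \<comment> \<open>The factor of \<open>v2\<close> makes it a unit vector, that of
    \<open>v1\<close> then makes the pairing of \<open>B *v w1\<close> with \<open>w2\<close> equal
    to 1, and that of \<open>v3\<close> is forced by \<open>herm w1 w3 = 1\<close>.\<close>
  define w1 where "w1 = (r / \<beta>) *s v1"
  define w2 where "w2 = (1 / r) *s v2"
  define w3 where "w3 = cnj (\<beta> / (r * herm v1 v3)) *s v3"
  have gram: "herm w1 w1 = 0" "herm w1 w2 = 0" "herm w2 w3 = 0" "herm w3 w3 = 0"
    "herm w1 w3 = 1" "herm w2 w2 = 1"
    using r a \<open>\<beta> \<noteq> 0\<close> \<open>b > 0\<close> by (simp_all add: w1_def w2_def w3_def herm_linear orth b)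
  have Bw: "herm (B *v w1) w2 = 1"
    using r \<open>\<beta> \<noteq> 0\<close> by (simp add: w1_def w2_def vec.scale herm_linear \<beta>_def[symmetric])
  have evw: "A *v w1 = d 1 *s w1" "A *v w2 = d 2 *s w2" "A *v w3 = d 3 *s w3"
    by (simp_all add: w1_def w2_def w3_def vec.scale ev mult.commute)
  \<comment> \<open>A common factor of modulus 1 corrects the determinant without changing any
    pairing.\<close>
  obtain c where c: "norm c = 1" "c ^ 3 * det (frame w1 w2 w3) = 1"
    using SU21_scalar_exists[OF frame_herm[OF gram]] .
  have cc: "c * cnj c = 1"
    using c(1) by (simp add: complex_norm_square[symmetric])
  define M where "M = frame (c *s w1) (c *s w2) (c *s w3)"
  have Mx: "M *v x = c *s (frame w1 w2 w3 *v x)" for x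
    by (simp add: M_def frame_mult vec_eq_iff algebra_simps)
  have scale: "herm (c *s x) (c *s y) = herm x y" for x y
    using cc by (simp add: herm_linear mult.commute mult.left_commute)
  have "det M = c ^ 3 * det (frame w1 w2 w3)"
    by (simp add: M_def det_3 frame_def power3_eq_cube algebra_simps)
  then have "M \<in> carrier SU21"
    using c by (simp add: SU21_simps Mx scale frame_herm[OF gram])
  moreover have "A ** M = M ** diag d"
    unfolding M_def by (rule frame_diag) (simp_all add: vec.scale evw mult.commute)
  moreover have "herm (B *v (M *v axis 1 1)) (M *v axis 2 1) = 1"
    by (simp add: M_def vec.scale scale Bw)
  ultimately show thesis
    using that B by blast
qed

text \<open>Coordinate \<open>i\<close> is a pairing with a basis vector, and the isometry
  \<open>M\<close> may be applied to both arguments. Entries thus become pairings to which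
  irreducibility applies.\<close>

lemma conjugate_entry:
  assumes M: "M \<in> carrier SU21" and g: "M ** g = mat 1"
  shows "(g ** B ** M) $ i $ j = herm (B *v (M *v axis j 1)) (M *v axis (flip i) 1)"
proof -
  have "(g ** B ** M) $ i $ j = herm (g *v (B *v (M *v axis j 1))) (axis (flip i) 1)"
    by (simp add: herm_axis matrix_vector_mul_assoc matrix_mul_assoc matrix_mult_axis)
  also have "\<dots> = herm (M *v (g *v (B *v (M *v axis j 1)))) (M *v axis (flip i) 1)"
    using M by (simp add: SU21_simps)
  also have "M *v (g *v (B *v (M *v axis j 1))) = B *v (M *v axis j 1)"
    by (simp add: matrix_vector_mul_assoc[of M g] g)
  finally show ?thesis .
qed

text \<open>The inverse of an isometry is its adjoint, and \<open>flip\<close> carries position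
  (3,2) to position (2,1) of the conjugate transpose.\<close>

lemma SU21_inverse_entry:
  assumes P: "P \<in> carrier SU21" and Q: "P ** Q = mat 1"
  shows "Q $ 3 $ 2 = cnj (P $ 2 $ 1)"
proof -
  have "Q $ 3 $ 2 = herm (Q *v axis 2 1) (axis 1 1)"
    using herm_axis[of "Q *v axis 2 1" 3] by (simp add: matrix_mult_axis)
  also have "\<dots> = herm (P *v (Q *v axis 2 1)) (P *v axis 1 1)"
    using P by (simp add: SU21_simps)
  also have "\<dots> = cnj (herm (P *v axis 1 1) (axis 2 1))"
    by (simp add: matrix_vector_mul_assoc[of P Q] Q cnj_herm)
  also have "\<dots> = cnj (P $ 2 $ 1)"
    using herm_axis[of "P *v axis 1 1" 2] by (simp add: matrix_mult_axis)
  finally show ?thesis .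
qed

section \<open>Conjugation into the field\<close>

theorem theoremA:
  fixes \<Gamma> :: "(complex^3^3) set" and A :: "complex^3^3" and l \<phi> :: real
  assumes "subgroup \<Gamma> SU21"
    and "irreducible_group \<Gamma>"
    and "A \<in> \<Gamma>"
    and "loxodromic A"
    and "l > 0" and "l \<noteq> 1"
    and "- pi < \<phi>" and "\<phi> \<le> pi"
    and "eigenvalues A = {of_real l * cis \<phi>, cis (- 2 * \<phi>), of_real (inverse l) * cis \<phi>}"
  shows "\<exists>g \<in> carrier SU21.
    subgroup (conjugate_by g \<Gamma>)
      (SU21\<lparr>carrier := SU21_over (trace_field_adjoin \<Gamma> (of_real l))\<rparr>)"
proof -
  interpret SU: group SU21 by (rule group_SU21)
  define u where "u = cis \<phi>"
  have u: "norm u = 1" "u \<noteq> 0" by (simp_all add: u_def)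
  define d :: "3 \<Rightarrow> complex" where
    "d i = (if i = 1 then of_real l * u else if i = 2 then inverse u ^ 2 else of_real (inverse l) * u)" for i
  have d_simps: "d 1 = of_real l * u" "d 2 = inverse u ^ 2" "d 3 = of_real (inverse l) * u"
    by (simp_all add: d_def)
  have norm_d: "norm (d 1) = l" "norm (d 2) = 1" "norm (d 3) = inverse l"
    using u \<open>l > 0\<close> by (simp_all add: d_simps norm_mult norm_power norm_inverse)
  have "l \<noteq> inverse l"
    using \<open>l > 0\<close> \<open>l \<noteq> 1\<close> by (metis inverse_less_1_iff less_asym linorder_neqE_linordered_idom not_less one_less_inverse_iff)
  \<comment> \<open>The moduli l, 1 and 1/l tell the eigenvalues apart.\<close>
  then have "inj d"
    using norm_d \<open>l \<noteq> 1\<close> by (intro injI) (metis exhaust_3 inverse_eq_1_iff)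
  have d_nz: "d i \<noteq> 0" for i
    using u \<open>l > 0\<close> by (auto simp: d_def)
  have "eigenvalues A = {d 1, d 2, d 3}"
    using assms(9) by (simp add: d_simps u_def Complex.DeMoivre cis_inverse)
  then have "d 1 \<in> eigenvalues A" "d 2 \<in> eigenvalues A" "d 3 \<in> eigenvalues A"
    by simp_all
  then obtain v1 v2 v3 where nz: "v1 \<noteq> 0" "v2 \<noteq> 0" "v3 \<noteq> 0"
    and ev: "A *v v1 = d 1 *s v1" "A *v v2 = d 2 *s v2" "A *v v3 = d 3 *s v3"
    unfolding eigenvalues_def by blast
  obtain M B where M: "M \<in> carrier SU21" and AM: "A ** M = M ** diag d" and "B \<in> \<Gamma>"
    and B: "herm (B *v (M *v axis 1 1)) (M *v axis 2 1) = 1"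
    using loxodromic_normal_frame[OF assms(1,2,4) ev nz \<open>inj d\<close>] norm_d \<open>l \<noteq> 1\<close> by auto
  define g where "g = inv\<^bsub>SU21\<^esub> M"
  have g: "g \<in> carrier SU21" and gM: "g ** M = mat 1" and Mg: "M ** g = mat 1"
    using M SU.l_inv[OF M] SU.r_inv[OF M] by (simp_all add: g_def SU21_simps(2,3))
  define G where "G = conjugate_by g \<Gamma>"
  have G_eq: "G = (\<lambda>h. g ** h ** M) ` \<Gamma>"
    using M by (simp add: G_def conjugate_by_def SU21_simps(2) g_def)
  have G: "subgroup G SU21"
    unfolding G_def using g assms(1) by (rule conjugate_by_subgroup)
  define K where "K = trace_field_adjoin \<Gamma> (of_real l)"
  interpret complex_subfield K
    unfolding K_def trace_field_adjoin_def by (rule complex_subfield_generate_field)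
  have l_mem: "of_real l \<in> K"
    unfolding K_def trace_field_adjoin_def by (rule generate_field.incl) simp
  have trace_mem: "trace C \<in> K" if C: "C \<in> G" for C
  proof -
    obtain h where h: "h \<in> \<Gamma>" "C = g ** h ** M"
      using C by (auto simp: G_eq)
    have "trace C = trace h"
      unfolding h(2) trace_mul_sym[of "g ** h" M] by (simp add: matrix_mul_assoc Mg)
    moreover have "trace h \<in> K"
      unfolding K_def trace_field_adjoin_def trace_field_def
      using h(1) by (intro generate_field.incl) (simp add: generate_field.incl)
    ultimately show ?thesis by simp
  qed
  have diag_in: "diag d \<in> G"
  proof -
    have "diag d = g ** A ** M"
      by (metis AM gM matrix_mul_assoc matrix_mul_lid)
    then show ?thesis
      using assms(3) by (auto simp: G_eq)
  qed
  \<comment> \<open>The trace of this inverse is the second of the two traces that determine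
    \<open>u\<close>.\<close>
  define E where "E = inv\<^bsub>SU21\<^esub> (diag d)"
  have "diag d ** E = mat 1"
    using SU.r_inv[OF subgroup.mem_carrier[OF G diag_in]] by (simp add: E_def SU21_simps(2,3))
  then have "d i * E $ i $ i = 1" for i
    using diag_mult_nth[of d E i i] by (simp add: mat_def)
  then have E_diag: "E $ i $ i = inverse (d i)" for i
    using inverse_unique by metis
  have "E \<in> G"
    unfolding E_def by (rule subgroup.m_inv_closed[OF G diag_in])
  have "u \<in> K"
  proof (rule unit_eigenvalue_mem[OF assms(5,6) l_mem u(1)])
    have "trace (diag d) = u * of_real (l + inverse l) + inverse u ^ 2"
      by (simp add: trace_def sum_3 diag_def d_simps algebra_simps)
    then show "u * of_real (l + inverse l) + inverse u ^ 2 \<in> K"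
      using trace_mem[OF diag_in] by simp
    have "trace E = inverse u * of_real (l + inverse l) + u ^ 2"
      by (simp add: trace_def sum_3 E_diag d_simps power_inverse algebra_simps)
    then show "inverse u * of_real (l + inverse l) + u ^ 2 \<in> K"
      using trace_mem[OF \<open>E \<in> G\<close>] by simp
  qed
  then have d_mem: "d i \<in> K" for i
    using l_mem unfolding d_def of_real_inverse by (simp add: arith_mem)
  define P where "P = g ** B ** M"
  have P: "P \<in> G" "P $ 2 $ 1 = 1"
    using \<open>B \<in> \<Gamma>\<close> B by (auto simp: P_def G_eq conjugate_entry[OF M Mg])
  define Q where "Q = inv\<^bsub>SU21\<^esub> P"
  note PSU = subgroup.mem_carrier[OF G P(1)]
  have "P ** Q = mat 1"
    using SU.r_inv[OF PSU] by (simp add: Q_def SU21_simps(2,3))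
  then have Q: "Q \<in> G" "Q $ 3 $ 2 = 1"
    using subgroup.m_inv_closed[OF G P(1)] SU21_inverse_entry[OF PSU] P(2) by (simp_all add: Q_def)
  \<comment> \<open>The columns of \<open>M\<close> are nonzero, so irreducibility makes their
    pairing nonzero for some group element.\<close>
  have "\<exists>C\<in>G. C $ i $ j \<noteq> 0" for i j
  proof -
    have "M *v axis k 1 \<noteq> 0" for k
    proof
      assume "M *v axis k 1 = 0"
      then have "g *v (M *v axis k 1) = 0" by simp
      then show False by (simp add: matrix_vector_mul_assoc gM axis_eq_0_iff)
    qed
    then show ?thesis
      using irreducible_pairing_nonzero[OF assms(1,2)]
      by (auto simp: G_eq conjugate_entry[OF M Mg])
  qed
  then interpret normalized_matrices K G d P Q
    using subgroup.m_closed[OF G] trace_mem \<open>inj d\<close> d_mem diag_in P Q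
    by unfold_locales (simp_all add: SU21_simps(2))
  have "G \<subseteq> SU21_over K"
    using all_entries_mem subgroup.mem_carrier[OF G] by (auto simp: SU21_over_def)
  then have "subgroup G (SU21\<lparr>carrier := SU21_over K\<rparr>)"
    by (intro SU.subgroup_restrict_carrier G) (auto simp: SU21_over_def)
  then show ?thesis
    using g unfolding G_def K_def by blast
qed

end
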